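(* Let $\mathfrak a$ be a set of regular cardinals, let $\mu=\sup\mathfrak a$ with $\mu\notin\mathfrak a$, and let $\lambda>\mu$ be a cardinal with $2^{<\lambda}=2^{\mu}$ and $\lambda\in\mathrm{pcf}(\mathfrak a)$. Assume moreover that there is an ideal $J$ on $\mathfrak a$ containing all bounded subsets of $\mathfrak a$ such that $\lambda=\mathrm{tcf}(\prod\mathfrak a/J)$. Then the forcing notion $\prod_{\kappa\in\mathfrak a}{}^{\kappa>}2$ adds a generic for ${}^{\lambda>}2$.
   Context: For a cardinal $\kappa$, ${}^{\kappa>}2$ denotes the set of all functions from some ordinal $\beta<\kappa$ into $\{0,1\}$, partially ordered by inclusion (i.e., sequence extension); this is the Cohen forcing on $\kappa$. The product $\prod_{\kappa\in\mathfrak a}{}^{\kappa>}2$ is the full product: its conditions are sequences $(p_\kappa:\kappa\in\mathfrak a)$ with $p_\kappa\in{}^{\kappa>}2$, ordered coordinatewise. "Adds a generic for ${}^{\lambda>}2$" means that in every generic extension by the product forcing there is a filter on ${}^{\lambda>}2$ which is generic over the ground model. For a set $\mathfrak a$ of regular cardinals, $\prod\mathfrak a$ is the set of functions $f$ with domain $\mathfrak a$ and $f(\kappa)\in\kappa$ for all $\kappa\in\mathfrak a$. A set $\mathfrak b\subseteq\mathfrak a$ is bounded if $\sup\mathfrak b<\sup\mathfrak a$. For an ideal $J$ on $\mathfrak a$ and $f,g\in\prod\mathfrak a$, $f<_J g$ means $\{\kappa\in\mathfrak a: f(\kappa)\not<g(\kappa)\}\in J$. $\mathrm{tcf}(\prod\mathfrak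 a/J)=\lambda$ means that there is a $<_J$-strictly increasing sequence of length $\lambda$ in $\prod\mathfrak a$ which is cofinal in $(\prod\mathfrak a,<_J)$. $\mathrm{pcf}(\mathfrak a)$ is the set of all $\lambda$ such that $\lambda=\mathrm{tcf}(\prod\mathfrak a/J)$ for some ideal $J$ on $\mathfrak a$. *)

theory Defs
  imports Main "HOL-Library.FuncSet"
begin

unbundle cardinal_syntax

section \<open>Ordinals and cardinals\<close>

text \<open>
  All ordinals under consideration are elements of an arbitrary well-ordered type; an element
  \<open>\<alpha>\<close> is identified with the order type of its set \<open>{..<\<alpha>}\<close> of predecessors.
\<close>

definition ord_rel :: "'o::wellorder \<Rightarrow> 'o rel" where
  "ord_rel \<alpha> = {(x, y). x \<le> y \<and> y < \<alpha>}"

definition is_cardinal :: "'o::wellorder \<Rightarrow> bool" where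
  "is_cardinal \<kappa> \<longleftrightarrow> Card_order (ord_rel \<kappa>)"

definition is_regular :: "'o::wellorder \<Rightarrow> bool" where
  "is_regular \<kappa> \<longleftrightarrow> Cinfinite (ord_rel \<kappa>) \<and> regularCard (ord_rel \<kappa>)"

definition is_sup :: "'o::wellorder set \<Rightarrow> 'o \<Rightarrow> bool" where
  "is_sup A s \<longleftrightarrow> (\<forall>x\<in>A. x \<le> s) \<and> (\<forall>u. (\<forall>x\<in>A. x \<le> u) \<longrightarrow> s \<le> u)"

text \<open>
  \<open>is_two_less_power \<Lambda> r\<close> says that the cardinal \<open>r\<close> is \<open>2\<^bsup><\<Lambda>\<^esup>\<close>, the supremum of the cardinals
  \<open>2\<^bsup>\<theta>\<^esup>\<close> for cardinals \<open>\<theta> < \<Lambda>\<close>. Comparing \<open>r\<close> only with upper bounds \<open>s\<close> on the same type loses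
  nothing, since every cardinal below \<open>r\<close> is represented on the type of \<open>r\<close>.
\<close>

definition is_two_less_power :: "'o::wellorder \<Rightarrow> 'c rel \<Rightarrow> bool" where
  "is_two_less_power \<Lambda> r \<longleftrightarrow> Card_order r \<and>
     (\<forall>\<theta><\<Lambda>. is_cardinal \<theta> \<longrightarrow> ctwo ^c ord_rel \<theta> \<le>o r) \<and>
     (\<forall>s :: 'c rel. Card_order s \<and> (\<forall>\<theta><\<Lambda>. is_cardinal \<theta> \<longrightarrow> ctwo ^c ord_rel \<theta> \<le>o s)
        \<longrightarrow> r \<le>o s)"


section \<open>True cofinality and pcf\<close>

definition prod_card :: "'o::wellorder set \<Rightarrow> ('o \<Rightarrow> 'o) set" where
  "prod_card \<aa> = (\<Pi>\<^sub>E \<kappa>\<in>\<aa>. {..<\<kappa>})"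

text \<open>Ideals are proper, as usual in pcf theory. For \<open>\<aa> \<in> J\<close>, \<open><\<^sub>J\<close> would hold between any two functions.\<close>

definition ideal_on :: "'o set \<Rightarrow> 'o set set \<Rightarrow> bool" where
  "ideal_on \<aa> J \<longleftrightarrow> J \<subseteq> Pow \<aa> \<and> {} \<in> J \<and> \<aa> \<notin> J \<and>
     (\<forall>X\<in>J. \<forall>Y. Y \<subseteq> X \<longrightarrow> Y \<in> J) \<and> (\<forall>X\<in>J. \<forall>Y\<in>J. X \<union> Y \<in> J)"

definition bounded_subset :: "'o::wellorder set \<Rightarrow> 'o set \<Rightarrow> bool" where
  "bounded_subset \<aa> \<bb> \<longleftrightarrow> \<bb> \<subseteq> \<aa> \<and> (\<exists>s t. is_sup \<bb> s \<and> is_sup \<aa> t \<and> s < t)"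

definition less_mod :: "'o::wellorder set \<Rightarrow> 'o set set \<Rightarrow> ('o \<Rightarrow> 'o) \<Rightarrow> ('o \<Rightarrow> 'o) \<Rightarrow> bool" where
  "less_mod \<aa> J f g \<longleftrightarrow> {\<kappa> \<in> \<aa>. \<not> f \<kappa> < g \<kappa>} \<in> J"

text \<open>
  \<open>is_tcf \<aa> J \<Lambda>\<close> renders \<open>tcf(\<Prod>\<aa>/J) = \<Lambda>\<close>. A true cofinality is by convention a regular cardinal;
  this is what makes the value unique, as a singular \<open>\<Lambda>\<close> can also be the length of an increasing
  cofinal sequence.
\<close>

definition is_tcf :: "'o::wellorder set \<Rightarrow> 'o set set \<Rightarrow> 'o \<Rightarrow> bool" where
  "is_tcf \<aa> J \<Lambda> \<longleftrightarrow> is_regular \<Lambda> \<and>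
     (\<exists>F. (\<forall>\<alpha><\<Lambda>. F \<alpha> \<in> prod_card \<aa>) \<and>
          (\<forall>\<alpha> \<beta>. \<alpha> < \<beta> \<and> \<beta> < \<Lambda> \<longrightarrow> less_mod \<aa> J (F \<alpha>) (F \<beta>)) \<and>
          (\<forall>g\<in>prod_card \<aa>. \<exists>\<alpha><\<Lambda>. less_mod \<aa> J g (F \<alpha>)))"

definition pcf :: "'o::wellorder set \<Rightarrow> 'o set" where
  "pcf \<aa> = {\<Lambda>. \<exists>J. ideal_on \<aa> J \<and> is_tcf \<aa> J \<Lambda>}"


section \<open>Forcing\<close>

text \<open>
  A forcing notion is a set \<open>P\<close> of conditions with a relation \<open>le\<close>, where \<open>le p q\<close> means that \<open>q\<close>
  is stronger than \<open>p\<close>. The ground model is the universe of HOL. Truth in every generic extension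
  is expressed by the forcing relation, given by the usual recursion on formulas; a formula of the
  forcing language is represented by the predicate \<open>\<phi>\<close> on conditions for which \<open>\<phi> p\<close> means that
  \<open>p\<close> forces it. Conjunctions and universal quantifiers (over ground model sets) are forced
  pointwise, so they are written with the connectives of HOL.
\<close>

definition dense_in :: "'p set \<Rightarrow> ('p \<Rightarrow> 'p \<Rightarrow> bool) \<Rightarrow> 'p set \<Rightarrow> bool" where
  "dense_in P le D \<longleftrightarrow> D \<subseteq> P \<and> (\<forall>p\<in>P. \<exists>d\<in>D. le p d)"

definition dense_below :: "'p set \<Rightarrow> ('p \<Rightarrow> 'p \<Rightarrow> bool) \<Rightarrow> 'p \<Rightarrow> 'p set \<Rightarrow> bool" where
  "dense_below P le p D \<longleftrightarrow> (\<forall>q\<in>P. le p q \<longrightarrow> (\<exists>r\<in>P. le q r \<and> r \<in> D))"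

definition forces_imp ::
  "'p set \<Rightarrow> ('p \<Rightarrow> 'p \<Rightarrow> bool) \<Rightarrow> ('p \<Rightarrow> bool) \<Rightarrow> ('p \<Rightarrow> bool) \<Rightarrow> 'p \<Rightarrow> bool" where
  "forces_imp P le \<phi> \<psi> p \<longleftrightarrow> (\<forall>q\<in>P. le p q \<and> \<phi> q \<longrightarrow> \<psi> q)"

definition forces_ex ::
  "'p set \<Rightarrow> ('p \<Rightarrow> 'p \<Rightarrow> bool) \<Rightarrow> 'x set \<Rightarrow> ('x \<Rightarrow> 'p \<Rightarrow> bool) \<Rightarrow> 'p \<Rightarrow> bool" where
  "forces_ex P le X \<phi> p \<longleftrightarrow> dense_below P le p {r. \<exists>x\<in>X. \<phi> x r}"

text \<open>
  A \<open>P\<close>-name for a subset of a ground model set \<open>Q\<close> is a set \<open>\<tau> \<subseteq> Q \<times> P\<close>; its evaluation by a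
  generic \<open>G\<close> is \<open>{q. \<exists>s\<in>G. (q, s) \<in> \<tau>}\<close>, and every subset of \<open>Q\<close> in the extension arises in this way.
\<close>

definition forces_mem ::
  "'p set \<Rightarrow> ('p \<Rightarrow> 'p \<Rightarrow> bool) \<Rightarrow> 'q \<Rightarrow> ('q \<times> 'p) set \<Rightarrow> 'p \<Rightarrow> bool" where
  "forces_mem P le q \<tau> p \<longleftrightarrow> dense_below P le p {r. \<exists>s. (q, s) \<in> \<tau> \<and> le s r}"

text \<open>
  \<open>p\<close> forces that \<open>\<tau>\<close> is a filter on \<open>Q\<close> (nonempty, closed under weakening, directed) which meets
  every dense subset of \<open>Q\<close> lying in the ground model.
\<close>

definition forces_generic_filter ::
  "'p set \<Rightarrow> ('p \<Rightarrow> 'p \<Rightarrow> bool) \<Rightarrow> 'q set \<Rightarrow> ('q \<Rightarrow> 'q \<Rightarrow> bool) \<Rightarrow> ('q \<times> 'p) set \<Rightarrow> 'p \<Rightarrow> bool"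
where
  "forces_generic_filter P le Q le' \<tau> p \<longleftrightarrow>
     forces_ex P le Q (\<lambda>q. forces_mem P le q \<tau>) p \<and>
     (\<forall>q\<in>Q. \<forall>q'\<in>Q. le' q' q \<longrightarrow>
        forces_imp P le (forces_mem P le q \<tau>) (forces_mem P le q' \<tau>) p) \<and>
     (\<forall>q\<in>Q. \<forall>q'\<in>Q.
        forces_imp P le (\<lambda>r. forces_mem P le q \<tau> r \<and> forces_mem P le q' \<tau> r)
          (forces_ex P le {s \<in> Q. le' q s \<and> le' q' s} (\<lambda>s. forces_mem P le s \<tau>)) p) \<and>
     (\<forall>D. dense_in Q le' D \<longrightarrow> forces_ex P le D (\<lambda>d. forces_mem P le d \<tau>) p)"

definition adds_generic ::
  "'p set \<Rightarrow> ('p \<Rightarrow> 'p \<Rightarrow> bool) \<Rightarrow> 'q set \<Rightarrow> ('q \<Rightarrow> 'q \<Rightarrow> bool) \<Rightarrow> bool" where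
  "adds_generic P le Q le' \<longleftrightarrow>
     (\<forall>p\<in>P. forces_ex P le (Pow (Q \<times> P)) (forces_generic_filter P le Q le') p)"


section \<open>Cohen forcing and full products\<close>

definition cohen :: "'o::wellorder \<Rightarrow> ('o \<rightharpoonup> bool) set" where
  "cohen \<kappa> = {p. \<exists>\<beta><\<kappa>. dom p = {..<\<beta>}}"

definition cohen_prod :: "'o::wellorder set \<Rightarrow> ('o \<Rightarrow> ('o \<rightharpoonup> bool)) set" where
  "cohen_prod \<aa> = (\<Pi>\<^sub>E \<kappa>\<in>\<aa>. cohen \<kappa>)"

definition cohen_prod_le ::
  "'o set \<Rightarrow> ('o \<Rightarrow> ('o \<rightharpoonup> bool)) \<Rightarrow> ('o \<Rightarrow> ('o \<rightharpoonup> bool)) \<Rightarrow> bool" where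
  "cohen_prod_le \<aa> p q \<longleftrightarrow> (\<forall>\<kappa>\<in>\<aa>. p \<kappa> \<subseteq>\<^sub>m q \<kappa>)"

end

theory Submission
  imports Defs
begin

text \<open>
  Let \<open>(F \<alpha>)\<close> for \<open>\<alpha> < \<Lambda>\<close> be a scale in \<open>\<Prod>\<aa>/J\<close>, and let \<open>\<eta> \<kappa>\<close> be the generic sequence in
  coordinate \<open>\<kappa>\<close>, viewed as a \<open>\<kappa> \<times> \<kappa>\<close> matrix by means of a pairing function \<open>\<pi> \<kappa>\<close>. As \<open>\<Lambda> > \<mu>\<close> is
  regular, some \<open>h\<close> in \<open>\<Prod>\<aa>\<close> exceeds every \<open>\<theta> < \<mu>\<close> modulo \<open>J\<close>, so row \<open>F \<alpha> \<kappa>\<close> of \<open>\<eta> \<kappa>\<close>, cut at \<open>h \<kappa>\<close>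
  and taken modulo \<open>J\<close>, encodes a subset of \<open>\<mu>\<close>. Since \<open>2\<^bsup><\<Lambda>\<^esup> = 2\<^bsup>\<mu>\<^esup>\<close>, subsets of \<open>\<mu>\<close> can be
  decoded onto the Cohen conditions on \<open>\<Lambda>\<close>. A condition of the product lies below some \<open>F \<alpha>\<close> modulo
  \<open>J\<close>, so it leaves the row of \<open>\<alpha>\<close> free, and it can be extended to one that decides all rows up to \<open>\<alpha>\<close>
  modulo \<open>J\<close>. The decoded conditions, followed along \<open>\<Lambda>\<close>, therefore generate a generic filter.
\<close>

section \<open>Cardinal arithmetic below an element of a well-order\<close>

lemma Field_ord_rel: "Field (ord_rel \<kappa>) = {..<\<kappa>}"
  by (auto simp: Field_def ord_rel_def)

lemma underS_ord_rel: "x < \<kappa> \<Longrightarrow> underS (ord_rel \<kappa>) x = {..<x}"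
  by (auto simp: underS_def ord_rel_def)

lemma ord_rel_Well_order: "Well_order (ord_rel \<kappa>)"
proof -
  have "wf (ord_rel \<kappa> - Id)"
    by (rule wf_subset[OF wf]) (auto simp: ord_rel_def)
  then show ?thesis
    unfolding well_order_on_def linear_order_on_def partial_order_on_def preorder_on_def Field_ord_rel
    by (auto simp: ord_rel_def refl_on_def trans_def antisym_def total_on_def)
qed

lemma is_regular_imp_is_cardinal: "is_regular \<kappa> \<Longrightarrow> is_cardinal \<kappa>"
  by (simp add: is_regular_def is_cardinal_def)

lemma is_regular_infinite: "is_regular \<kappa> \<Longrightarrow> infinite {..<\<kappa>}"
  by (simp add: is_regular_def cinfinite_def Field_ord_rel)

lemma card_of_lessThan_less:
  assumes "is_cardinal \<kappa>" "x < \<kappa>"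
  shows "|{..<x}| <o |{..<\<kappa>}|"
proof -
  have C: "Card_order (ord_rel \<kappa>)" using assms by (simp add: is_cardinal_def)
  then have "|{..<x}| <o ord_rel \<kappa>"
    using card_of_underS[OF C, of x] assms by (simp add: Field_ord_rel underS_ord_rel)
  moreover have "ord_rel \<kappa> =o |{..<\<kappa>}|"
    using card_of_Field_ordIso[OF C] by (simp add: Field_ord_rel ordIso_symmetric)
  ultimately show ?thesis by (rule ordLess_ordIso_trans)
qed

text \<open>A set without such a bound is cofinal in the strict sense of \<open>cofinal\<close>, so
  \<open>regularCard\<close> would give it full size.\<close>

lemma is_regular_bounded:
  assumes "is_regular \<kappa>" "K \<subseteq> {..<\<kappa>}" "|K| <o |{..<\<kappa>}|"
  shows "\<exists>x<\<kappa>. \<forall>y\<in>K. y \<le> x"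
proof (rule ccontr)
  assume unbounded: "\<not> ?thesis"
  have "cofinal K (ord_rel \<kappa>)"
    unfolding cofinal_def Field_ord_rel
  proof
    fix x assume "x \<in> {..<\<kappa>}"
    then obtain y where "y \<in> K" "x < y" using unbounded by (auto simp: not_le)
    then show "\<exists>y\<in>K. x \<noteq> y \<and> (x, y) \<in> ord_rel \<kappa>"
      using assms(2) by (auto simp: ord_rel_def intro!: bexI[of _ y])
  qed
  then have "|K| =o ord_rel \<kappa>"
    using assms by (auto simp: is_regular_def regularCard_def Field_ord_rel)
  moreover have "ord_rel \<kappa> =o |{..<\<kappa>}|"
    using assms(1) card_of_Field_ordIso[of "ord_rel \<kappa>"]
    by (simp add: is_regular_def Field_ord_rel ordIso_symmetric)
  ultimately have "|K| =o |{..<\<kappa>}|" by (rule ordIso_transitive)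
  then show False using assms(3) not_ordLess_ordIso by blast
qed

lemma is_regular_image_bounded:
  assumes "is_regular \<kappa>" "f ` A \<subseteq> {..<\<kappa>}" "|A| <o |{..<\<kappa>}|"
  shows "\<exists>x<\<kappa>. \<forall>a\<in>A. f a \<le> x"
  using is_regular_bounded[OF assms(1,2)] ordLeq_ordLess_trans[OF card_of_image assms(3)] by auto

text \<open>If \<open>x\<close> were the largest predecessor of \<open>\<kappa>\<close>, removing
  this one point from the infinite segment would keep its size, against
  \<open>card_of_lessThan_less\<close>.\<close>

lemma is_regular_greater:
  assumes "is_regular \<kappa>" "x < \<kappa>"
  shows "\<exists>y<\<kappa>. x < y"
proof (rule ccontr)
  assume "\<not> ?thesis"
  then have "y \<le> x" if "y < \<kappa>" for y using that not_le by blast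
  then have "{..<\<kappa>} = insert x {..<x}" using assms(2) by (auto simp: less_le)
  moreover from this have "infinite {..<x}" using is_regular_infinite[OF assms(1)] by auto
  ultimately have "|{..<\<kappa>}| =o |{..<x}|"
    using infinite_imp_bij_betw2[of "{..<x}" x] card_of_ordIso ordIso_symmetric
    by (metis Un_insert_right sup_bot_right)
  then show False
    using card_of_lessThan_less[OF is_regular_imp_is_cardinal[OF assms(1)] assms(2)]
      not_ordLess_ordIso ordIso_symmetric by blast
qed

lemma Restr_ord_rel: "x < \<kappa> \<Longrightarrow> Restr (ord_rel \<kappa>) {..<x} = ord_rel x"
  by (auto simp: ord_rel_def)

text \<open>The bounds in \<open>is_two_less_power\<close> speak of cardinals only; this carries
  them over to arbitrary ordinals. The least ordinal equipollent with \<open>\<beta>\<close>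
  serves.\<close>

lemma ex_equipollent_cardinal:
  fixes \<beta> :: "'o::wellorder"
  obtains \<theta> where "\<theta> \<le> \<beta>" "is_cardinal \<theta>" "|{..<\<theta>}| =o |{..<\<beta>}|"
proof
  let ?P = "\<lambda>\<theta>::'o. |{..<\<theta>}| =o |{..<\<beta>}|"
  define \<theta> where "\<theta> = (LEAST \<theta>. ?P \<theta>)"
  have P: "?P \<beta>" by (rule card_of_refl)
  show eq: "?P \<theta>" unfolding \<theta>_def by (rule LeastI[of ?P, OF P])
  show "\<theta> \<le> \<beta>" unfolding \<theta>_def by (rule Least_le[of ?P, OF P])
  \<comment> \<open>Otherwise the smaller ordinal \<open>x\<close> would also be equipollent with
    \<open>\<beta>\<close>, against minimality.\<close>
  have "ord_rel x <o |{..<\<theta>}|" if "x < \<theta>" for x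
  proof (rule ccontr)
    assume "\<not> ?thesis"
    then have "|{..<\<theta>}| \<le>o ord_rel x"
      using ord_rel_Well_order card_of_Well_order not_ordLess_iff_ordLeq by blast
    from card_of_mono2[OF this] have "|{..<\<theta>}| \<le>o |{..<x}|"
      by (simp add: Field_ord_rel Field_card_of)
    moreover have "|{..<x}| \<le>o |{..<\<theta>}|"
      using that by (intro card_of_mono1) auto
    ultimately have "?P x" using eq ordIso_iff_ordLeq ordIso_transitive by blast
    then show False using not_less_Least[of x ?P] that unfolding \<theta>_def by blast
  qed
  then show "is_cardinal \<theta>"
    unfolding is_cardinal_def Card_order_iff_Restr_underS[OF ord_rel_Well_order]
    by (simp add: Field_ord_rel underS_ord_rel Restr_ord_rel)
qed

section \<open>Counting the Cohen conditions\<close>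

lemma cexp_ctwo_ord_rel: "ctwo ^c ord_rel \<theta> =o |Pow {..<\<theta>}|"
  unfolding cexp_def ctwo_def Field_ord_rel Field_card_of
  using card_of_Pow_Func ordIso_symmetric by blast


text \<open>There are at most 2^\<mu> conditions of each length, and at most 2^\<mu> lengths. This
  bound yields the surjection \<open>decode\<close>.\<close>

lemma card_of_cohen:
  assumes "is_cardinal \<Lambda>" "\<mu> < \<Lambda>" "infinite {..<\<mu>}"
    and two: "is_two_less_power \<Lambda> (ctwo ^c ord_rel \<mu>)"
  shows "|cohen \<Lambda>| \<le>o |Pow {..<\<mu>}|"
proof -
  have Pow_le: "|Pow {..<\<beta>}| \<le>o |Pow {..<\<mu>}|" if "\<beta> < \<Lambda>" for \<beta>
  proof -
    obtain \<theta> where \<theta>: "\<theta> \<le> \<beta>" "is_cardinal \<theta>" "|{..<\<theta>}| =o |{..<\<beta>}|"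
      by (rule ex_equipollent_cardinal)
    have "ctwo ^c ord_rel \<theta> \<le>o ctwo ^c ord_rel \<mu>"
      using two \<theta> that unfolding is_two_less_power_def by auto
    then have "|Pow {..<\<theta>}| \<le>o |Pow {..<\<mu>}|"
      using cexp_ctwo_ord_rel ordIso_symmetric ordIso_ordLeq_trans ordLeq_ordIso_trans by blast
    moreover have "|Pow {..<\<beta>}| =o |Pow {..<\<theta>}|"
      using ordIso_symmetric[OF \<theta>(3)] bij_betw_Pow unfolding card_of_ordIso[symmetric] by blast
    ultimately show ?thesis using ordIso_ordLeq_trans by blast
  qed
  \<comment> \<open>If 2^\<mu> were below \<open>\<Lambda>\<close>, it would be the size of some
    \<open>\<beta> < \<Lambda>\<close>, and then 2^\<beta> would be at most 2^\<mu>, the size of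
    \<open>\<beta>\<close>, contradicting Cantor.\<close>
  have \<Lambda>_le: "|{..<\<Lambda>}| \<le>o |Pow {..<\<mu>}|"
  proof (rule ccontr)
    assume "\<not> ?thesis"
    then have "|Pow {..<\<mu>}| <o |{..<\<Lambda>}|" 
      using not_ordLeq_iff_ordLess[OF card_of_Well_order card_of_Well_order] by blast
    also have "|{..<\<Lambda>}| =o ord_rel \<Lambda>"
      using assms(1) card_of_Field_ordIso[of "ord_rel \<Lambda>"] by (simp add: is_cardinal_def Field_ord_rel)
    finally obtain \<beta> where \<beta>: "\<beta> < \<Lambda>" "|Pow {..<\<mu>}| =o Restr (ord_rel \<Lambda>) (underS (ord_rel \<Lambda>) \<beta>)"
      unfolding ordLess_iff_ordIso_Restr[OF ord_rel_Well_order card_of_Well_order] Field_ord_rel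
      by blast
    then have "|Pow {..<\<mu>}| =o ord_rel \<beta>" by (simp add: underS_ord_rel Restr_ord_rel)
    then have "|Pow {..<\<mu>}| \<le>o |{..<\<beta>}|"
      using card_of_mono2[of "|Pow {..<\<mu>}|" "ord_rel \<beta>"] by (simp add: Field_ord_rel Field_card_of ordIso_imp_ordLeq)
    then have "|Pow {..<\<beta>}| \<le>o |{..<\<beta>}|" using Pow_le[OF \<beta>(1)] ordLeq_transitive by blast
    then show False using card_of_Pow not_ordLeq_ordLess by blast
  qed
  have "infinite (Pow {..<\<mu>})" using assms(3) by simp
  then have "|\<Union>\<beta>\<in>{..<\<Lambda>}. (\<lambda>X x. if x < \<beta> then Some (x \<in> X) else None) ` Pow {..<\<beta>}| \<le>o |Pow {..<\<mu>}|"
    using \<Lambda>_le Pow_le card_of_image ordLeq_transitive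
    by (intro card_of_UNION_ordLeq_infinite) blast+
  moreover have "cohen \<Lambda> \<subseteq> (\<Union>\<beta>\<in>{..<\<Lambda>}. (\<lambda>X x. if x < \<beta> then Some (x \<in> X) else None) ` Pow {..<\<beta>})"
  proof
    fix p assume "p \<in> cohen \<Lambda>"
    then obtain \<beta> where \<beta>: "\<beta> < \<Lambda>" "dom p = {..<\<beta>}" by (auto simp: cohen_def)
    have "p = (\<lambda>x. if x < \<beta> then Some (x \<in> {x. p x = Some True}) else None)"
    proof
      fix x
      have "x < \<beta> \<longleftrightarrow> p x \<noteq> None" using \<beta>(2) by (metis domIff lessThan_iff)
      then show "p x = (if x < \<beta> then Some (x \<in> {x. p x = Some True}) else None)"
        by (cases "p x") auto
    qed
    moreover have "{x. p x = Some True} \<in> Pow {..<\<beta>}" using \<beta>(2) by (auto simp: set_eq_iff dom_def)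
    ultimately show "p \<in> (\<Union>\<beta>\<in>{..<\<Lambda>}. (\<lambda>X x. if x < \<beta> then Some (x \<in> X) else None) ` Pow {..<\<beta>})"
      using \<beta>(1) by blast
  qed
  ultimately show ?thesis using card_of_mono1 ordLeq_transitive by blast
qed

lemma is_regular_pairing:
  assumes "is_regular \<kappa>"
  obtains f where "inj_on f ({..<\<kappa>} \<times> {..<\<kappa>})" "f ` ({..<\<kappa>} \<times> {..<\<kappa>}) \<subseteq> {..<\<kappa>}"
proof -
  have "|{..<\<kappa>} \<times> {..<\<kappa>}| \<le>o |{..<\<kappa>}|"
    using card_of_Times_same_infinite is_regular_infinite[OF assms] ordIso_imp_ordLeq by blast
  then show ?thesis using that by (auto simp: card_of_ordLeq[symmetric])
qed

section \<open>Chains of partial functions\<close>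

text \<open>Defined by choice for arbitrary \<open>C\<close>: where members disagree, one of their
  values is picked. For a chain this is a common extension.\<close>

definition map_Union :: "('a \<rightharpoonup> 'b) set \<Rightarrow> 'a \<rightharpoonup> 'b" where
  "map_Union C x = (if \<exists>r\<in>C. x \<in> dom r then (SOME r. r \<in> C \<and> x \<in> dom r) x else None)"

lemma map_Union_eq:
  assumes "r \<in> C" "x \<in> dom r"
  obtains s where "s \<in> C" "x \<in> dom s" "map_Union C x = s x"
proof
  let ?s = "SOME r. r \<in> C \<and> x \<in> dom r"
  have "?s \<in> C \<and> x \<in> dom ?s"
    using assms by (intro someI[where P = "\<lambda>r. r \<in> C \<and> x \<in> dom r"]) auto
  then show "?s \<in> C" "x \<in> dom ?s" by auto
  show "map_Union C x = ?s x" using assms unfolding map_Union_def by (intro if_P) blast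
qed

lemma dom_map_Union: "dom (map_Union C) = (\<Union>r\<in>C. dom r)"
proof
  show "dom (map_Union C) \<subseteq> (\<Union>r\<in>C. dom r)"
  proof
    fix x assume "x \<in> dom (map_Union C)"
    then have "map_Union C x \<noteq> None" by (simp add: domIff)
    then have "\<exists>r\<in>C. x \<in> dom r" unfolding map_Union_def by (metis (no_types, lifting))
    then show "x \<in> (\<Union>r\<in>C. dom r)" by blast
  qed
  show "(\<Union>r\<in>C. dom r) \<subseteq> dom (map_Union C)"
  proof
    fix x assume "x \<in> (\<Union>r\<in>C. dom r)"
    then obtain r where "r \<in> C" "x \<in> dom r" by blast
    then show "x \<in> dom (map_Union C)" by (rule map_Union_eq) (simp add: domIff)
  qed
qed

lemma map_Union_upper:
  assumes "\<And>r s. r \<in> C \<Longrightarrow> s \<in> C \<Longrightarrow> r \<subseteq>\<^sub>m s \<or> s \<subseteq>\<^sub>m r" "r \<in> C"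
  shows "r \<subseteq>\<^sub>m map_Union C"
proof (unfold map_le_def, intro ballI)
  fix x assume x: "x \<in> dom r"
  obtain s where s: "s \<in> C" "x \<in> dom s" "map_Union C x = s x"
    using assms(2) x by (rule map_Union_eq)
  from assms(1)[OF assms(2) s(1)] have "r x = s x"
    using x s(2) by (metis map_le_def)
  then show "r x = map_Union C x" using s(3) by simp
qed

text \<open>
  Follows the requests \<open>t \<alpha>\<close> one after another, ignoring those that do not extend what has
  been reached before. This replaces concatenation, hence ordinal addition.
\<close>

function follow :: "('o::wellorder \<Rightarrow> 'a \<rightharpoonup> 'b) \<Rightarrow> 'o \<Rightarrow> 'a \<rightharpoonup> 'b" where
  "follow t \<alpha> =
     (let r = map_Union (follow t ` {..<\<alpha>}) in if r \<subseteq>\<^sub>m t \<alpha> then t \<alpha> else r)"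
  by pat_completeness auto
termination
  by (relation "inv_image {(x, y). x < y} snd") (auto intro: wf)

declare follow.simps [simp del]

abbreviation follow_below :: "('o::wellorder \<Rightarrow> 'a \<rightharpoonup> 'b) \<Rightarrow> 'o \<Rightarrow> 'a \<rightharpoonup> 'b" where
  "follow_below t \<alpha> \<equiv> map_Union (follow t ` {..<\<alpha>})"

lemma follow_below_le: "follow_below t \<alpha> \<subseteq>\<^sub>m follow t \<alpha>"
  by (simp add: follow.simps[of t \<alpha>] Let_def)

lemma follow_eq: "follow_below t \<alpha> \<subseteq>\<^sub>m t \<alpha> \<Longrightarrow> follow t \<alpha> = t \<alpha>"
  by (simp add: follow.simps[of t \<alpha>] Let_def)

text \<open>Holds whatever \<open>t\<close> requests: by induction the earlier stages form a chain,
  so their union extends each of them, and a stage never drops what this union has reached.\<close>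

lemma follow_mono: "\<beta> \<le> \<alpha> \<Longrightarrow> follow t \<beta> \<subseteq>\<^sub>m follow t \<alpha>"
proof (induction \<alpha> arbitrary: \<beta> rule: less_induct)
  case (less \<alpha>)
  show ?case
  proof (cases "\<beta> = \<alpha>")
    case False
    with less.prems have "\<beta> < \<alpha>" by simp
    then have "follow t \<beta> \<subseteq>\<^sub>m follow_below t \<alpha>"
      using less.IH by (intro map_Union_upper) (auto, metis linear)
    then show ?thesis using follow_below_le map_le_trans by blast
  qed simp
qed

text \<open>Locality of the recursion: a condition that settles the requests up to
  \<open>\<alpha>\<close> thereby settles stage \<open>\<alpha>\<close>.\<close>

lemma follow_cong: "(\<And>\<beta>. \<beta> \<le> \<alpha> \<Longrightarrow> t \<beta> = t' \<beta>) \<Longrightarrow> follow t \<alpha> = follow t' \<alpha>"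
proof (induction \<alpha> rule: less_induct)
  case (less \<alpha>)
  have "follow t ` {..<\<alpha>} = follow t' ` {..<\<alpha>}"
    using less by (intro image_cong) auto
  then show ?case using less.prems[of \<alpha>] by (simp add: follow.simps[of _ \<alpha>])
qed

text \<open>Membership in \<open>cohen \<Lambda>\<close> concerns the domain alone. Fewer than
  \<open>\<Lambda>\<close> lengths have a common bound below \<open>\<Lambda>\<close> by regularity,
  and a union of initial segments is an initial segment.\<close>

lemma map_Union_cohen:
  assumes "is_regular \<Lambda>" "\<alpha> < \<Lambda>" "\<And>\<beta>. \<beta> < \<alpha> \<Longrightarrow> c \<beta> \<in> cohen \<Lambda>"
  shows "map_Union (c ` {..<\<alpha>}) \<in> cohen \<Lambda>"
proof -
  have "\<forall>\<beta>\<in>{..<\<alpha>}. \<exists>\<gamma><\<Lambda>. dom (c \<beta>) = {..<\<gamma>}"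
    using assms(3) by (simp add: cohen_def)
  then obtain \<gamma> where \<gamma>: "\<And>\<beta>. \<beta> < \<alpha> \<Longrightarrow> \<gamma> \<beta> < \<Lambda> \<and> dom (c \<beta>) = {..<\<gamma> \<beta>}" by (metis lessThan_iff)
  obtain b where b: "b < \<Lambda>" "\<forall>\<beta>\<in>{..<\<alpha>}. \<gamma> \<beta> \<le> b"
    using is_regular_image_bounded[OF assms(1), of \<gamma> "{..<\<alpha>}"] \<gamma>
      card_of_lessThan_less[OF is_regular_imp_is_cardinal[OF assms(1)] assms(2)] by blast
  define d where "d = dom (map_Union (c ` {..<\<alpha>}))"
  have d: "d = (\<Union>\<beta><\<alpha>. {..<\<gamma> \<beta>})" using \<gamma> by (auto simp: d_def dom_map_Union)
  have nb: "b \<notin> d" using b(2) by (auto simp: d not_less)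
  \<comment> \<open>The set \<open>d\<close> is downward closed and omits \<open>b\<close>, so its
    least missing point exists and is its length.\<close>
  have "d = {..<(LEAST y. y \<notin> d)}"
  proof (intro equalityI subsetI)
    fix x assume "x \<in> d"
    then have "{..x} \<subseteq> d" by (auto simp: d)
    moreover have "(LEAST y. y \<notin> d) \<notin> d" using nb by (rule LeastI)
    ultimately show "x \<in> {..<(LEAST y. y \<notin> d)}" by (auto simp: not_le[symmetric])
  qed (use not_less_Least in blast)
  moreover have "(LEAST y. y \<notin> d) < \<Lambda>" using Least_le[of "\<lambda>y. y \<notin> d", OF nb] b(1) by simp
  ultimately show ?thesis by (auto simp: cohen_def d_def)
qed

lemma follow_cohen:
  assumes "is_regular \<Lambda>" "\<And>\<beta>. t \<beta> \<in> cohen \<Lambda>"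
  shows "\<alpha> < \<Lambda> \<Longrightarrow> follow t \<alpha> \<in> cohen \<Lambda>"
proof (induction \<alpha> rule: less_induct)
  case (less \<alpha>)
  then have "follow_below t \<alpha> \<in> cohen \<Lambda>" using assms(1) by (intro map_Union_cohen) auto
  then show ?case using assms(2) by (subst follow.simps) (simp add: Let_def)
qed

section \<open>Decoding a Cohen product along a scale\<close>

text \<open>A condition has bounded length in each coordinate. Cutting columns at \<open>h\<close>
  keeps the rows up to \<open>F \<alpha> \<kappa>\<close> in a rectangle that occupies a bounded
  part of \<open>\<kappa>\<close>, while \<open>h_large\<close> lets each
  \<open>\<theta> < \<mu>\<close> survive the cut for \<open>J\<close>-almost all
  \<open>\<kappa>\<close>.\<close>

locale coding =
  fixes \<aa> :: "'o::wellorder set" and J :: "'o set set" and \<mu> \<Lambda> :: 'o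
    and F :: "'o \<Rightarrow> 'o \<Rightarrow> 'o" and h :: "'o \<Rightarrow> 'o"
    and \<pi> :: "'o \<Rightarrow> 'o \<times> 'o \<Rightarrow> 'o" and decode :: "'o set \<Rightarrow> 'o \<rightharpoonup> bool"
  assumes regular: "\<And>\<kappa>. \<kappa> \<in> \<aa> \<Longrightarrow> is_regular \<kappa>"
    and regular_\<Lambda>: "is_regular \<Lambda>"
    and ideal: "ideal_on \<aa> J"
    and F_prod: "\<And>\<alpha>. \<alpha> < \<Lambda> \<Longrightarrow> F \<alpha> \<in> prod_card \<aa>"
    and F_less: "\<And>\<alpha> \<beta>. \<alpha> < \<beta> \<Longrightarrow> \<beta> < \<Lambda> \<Longrightarrow> less_mod \<aa> J (F \<alpha>) (F \<beta>)"
    and F_cofinal: "\<And>g. g \<in> prod_card \<aa> \<Longrightarrow> \<exists>\<alpha><\<Lambda>. less_mod \<aa> J g (F \<alpha>)"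
    and h_less: "\<And>\<kappa>. \<kappa> \<in> \<aa> \<Longrightarrow> h \<kappa> < \<kappa>"
    and h_large: "\<And>\<theta>. \<theta> < \<mu> \<Longrightarrow> {\<kappa>\<in>\<aa>. \<not> \<theta> < h \<kappa>} \<in> J"
    and inj_\<pi>: "\<And>\<kappa>. \<kappa> \<in> \<aa> \<Longrightarrow> inj_on (\<pi> \<kappa>) ({..<\<kappa>} \<times> {..<\<kappa>})"
    and \<pi>_less: "\<And>\<kappa> \<gamma> \<theta>. \<kappa> \<in> \<aa> \<Longrightarrow> \<gamma> < \<kappa> \<Longrightarrow> \<theta> < \<kappa> \<Longrightarrow> \<pi> \<kappa> (\<gamma>, \<theta>) < \<kappa>"
    and decode_onto: "decode ` Pow {..<\<mu>} = cohen \<Lambda>"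
begin

lemma \<pi>_eqD:
  assumes "\<pi> \<kappa> (\<gamma>, \<theta>) = \<pi> \<kappa> (\<gamma>', \<theta>')" "\<kappa> \<in> \<aa>" "\<gamma> < \<kappa>" "\<theta> < \<kappa>" "\<gamma>' < \<kappa>" "\<theta>' < \<kappa>"
  shows "\<gamma> = \<gamma>'" "\<theta> = \<theta>'"
  using inj_onD[OF inj_\<pi>[OF assms(2)] assms(1)] assms(3-) by simp_all

lemma F_bound: "\<alpha> < \<Lambda> \<Longrightarrow> \<kappa> \<in> \<aa> \<Longrightarrow> F \<alpha> \<kappa> < \<kappa>"
  using F_prod[of \<alpha>] by (auto simp: prod_card_def PiE_iff)

lemma ideal_mono: "X \<in> J \<Longrightarrow> Y \<subseteq> X \<Longrightarrow> Y \<in> J"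
  using ideal by (auto simp: ideal_on_def)

lemma ideal_Un: "X \<in> J \<Longrightarrow> Y \<in> J \<Longrightarrow> X \<union> Y \<in> J"
  using ideal by (auto simp: ideal_on_def)

lemma ideal_proper: "\<aa> \<notin> J"
  using ideal by (auto simp: ideal_on_def)

section \<open>Rows modulo the ideal\<close>

text \<open>Undefined bits count as not \<open>True\<close>, and \<open>\<theta>\<close> is also
  left out when its bits are neither almost all \<open>True\<close> nor almost all
  \<open>False\<close>. Thus every \<open>q\<close>, even one that is not a condition, yields a
  subset of \<open>\<mu>\<close>.\<close>

definition read :: "('o \<Rightarrow> 'o \<rightharpoonup> bool) \<Rightarrow> 'o \<Rightarrow> 'o set" where
  "read q \<beta> = {\<theta>. \<theta> < \<mu> \<and> {\<kappa>\<in>\<aa>. q \<kappa> (\<pi> \<kappa> (F \<beta> \<kappa>, \<theta>)) \<noteq> Some True} \<in> J}"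

text \<open>The exceptional set may vary with \<open>\<beta>\<close> and \<open>\<theta>\<close>,
  since \<open>J\<close> is only assumed closed under finite unions.\<close>

definition decides :: "('o \<Rightarrow> 'o \<rightharpoonup> bool) \<Rightarrow> 'o \<Rightarrow> bool" where
  "decides q \<alpha> \<longleftrightarrow> (\<forall>\<beta>\<le>\<alpha>. \<forall>\<theta><\<mu>. {\<kappa>\<in>\<aa>. \<pi> \<kappa> (F \<beta> \<kappa>, \<theta>) \<notin> dom (q \<kappa>)} \<in> J)"

abbreviation requests :: "('o \<Rightarrow> 'o \<rightharpoonup> bool) \<Rightarrow> 'o \<Rightarrow> 'o \<rightharpoonup> bool" where
  "requests q \<beta> \<equiv> decode (read q \<beta>)"

lemma requests_cohen: "requests q \<beta> \<in> cohen \<Lambda>"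
  using decode_onto by (auto simp: read_def)

lemma read_cong:
  assumes "\<And>\<theta>. \<theta> < \<mu> \<Longrightarrow>
    {\<kappa>\<in>\<aa>. q \<kappa> (\<pi> \<kappa> (F \<beta> \<kappa>, \<theta>)) \<noteq> q' \<kappa> (\<pi> \<kappa> (F \<beta> \<kappa>, \<theta>))} \<in> J"
  shows "read q \<beta> = read q' \<beta>"
proof -
  have "{\<kappa>\<in>\<aa>. q \<kappa> (\<pi> \<kappa> (F \<beta> \<kappa>, \<theta>)) \<noteq> Some True} \<in> J \<longleftrightarrow>
      {\<kappa>\<in>\<aa>. q' \<kappa> (\<pi> \<kappa> (F \<beta> \<kappa>, \<theta>)) \<noteq> Some True} \<in> J" if \<theta>: "\<theta> < \<mu>" for \<theta>
  proof
    assume "{\<kappa>\<in>\<aa>. q \<kappa> (\<pi> \<kappa> (F \<beta> \<kappa>, \<theta>)) \<noteq> Some True} \<in> J"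
    from ideal_Un[OF this assms[OF \<theta>]]
    show "{\<kappa>\<in>\<aa>. q' \<kappa> (\<pi> \<kappa> (F \<beta> \<kappa>, \<theta>)) \<noteq> Some True} \<in> J" by (rule ideal_mono) auto
  next
    assume "{\<kappa>\<in>\<aa>. q' \<kappa> (\<pi> \<kappa> (F \<beta> \<kappa>, \<theta>)) \<noteq> Some True} \<in> J"
    from ideal_Un[OF this assms[OF \<theta>]]
    show "{\<kappa>\<in>\<aa>. q \<kappa> (\<pi> \<kappa> (F \<beta> \<kappa>, \<theta>)) \<noteq> Some True} \<in> J" by (rule ideal_mono) auto
  qed
  then show ?thesis by (auto simp: read_def)
qed

lemma decides_stronger:
  assumes "decides q \<alpha>" "cohen_prod_le \<aa> q r"
  shows "decides r \<alpha>"
  unfolding decides_def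
proof (intro allI impI)
  fix \<beta> \<theta> assume "\<beta> \<le> \<alpha>" "\<theta> < \<mu>"
  then have "{\<kappa>\<in>\<aa>. \<pi> \<kappa> (F \<beta> \<kappa>, \<theta>) \<notin> dom (q \<kappa>)} \<in> J"
    using assms(1) by (simp add: decides_def)
  moreover have "dom (q \<kappa>) \<subseteq> dom (r \<kappa>)" if "\<kappa> \<in> \<aa>" for \<kappa>
    using assms(2) that by (simp add: cohen_prod_le_def map_le_implies_dom_le)
  then have "{\<kappa>\<in>\<aa>. \<pi> \<kappa> (F \<beta> \<kappa>, \<theta>) \<notin> dom (r \<kappa>)} \<subseteq> {\<kappa>\<in>\<aa>. \<pi> \<kappa> (F \<beta> \<kappa>, \<theta>) \<notin> dom (q \<kappa>)}"
    by blast
  ultimately show "{\<kappa>\<in>\<aa>. \<pi> \<kappa> (F \<beta> \<kappa>, \<theta>) \<notin> dom (r \<kappa>)} \<in> J" by (rule ideal_mono)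
qed

text \<open>An extension changes bits only where \<open>q\<close> is undefined, and these places are
  negligible in every decided row.\<close>

lemma requests_stronger:
  assumes "decides q \<alpha>" "cohen_prod_le \<aa> q r" "\<beta> \<le> \<alpha>"
  shows "requests q \<beta> = requests r \<beta>"
proof -
  have "read q \<beta> = read r \<beta>"
  proof (rule read_cong)
    fix \<theta> assume "\<theta> < \<mu>"
    then have "{\<kappa>\<in>\<aa>. \<pi> \<kappa> (F \<beta> \<kappa>, \<theta>) \<notin> dom (q \<kappa>)} \<in> J"
      using assms by (auto simp: decides_def)
    then show "{\<kappa>\<in>\<aa>. q \<kappa> (\<pi> \<kappa> (F \<beta> \<kappa>, \<theta>)) \<noteq> r \<kappa> (\<pi> \<kappa> (F \<beta> \<kappa>, \<theta>))} \<in> J"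
      by (rule ideal_mono) (use assms(2) in \<open>auto simp: cohen_prod_le_def map_le_def\<close>)
  qed
  then show ?thesis by simp
qed

section \<open>The name of the generic filter\<close>

text \<open>Names the filter generated by the stages of \<open>follow\<close>. Admitting all
  \<open>s\<close> below a stage gives closure under weakening; demanding \<open>decides\<close>
  makes the stage immune to strengthening \<open>q\<close>.\<close>

definition name :: "(('o \<rightharpoonup> bool) \<times> ('o \<Rightarrow> 'o \<rightharpoonup> bool)) set" where
  "name = {(s, q). s \<in> cohen \<Lambda> \<and> q \<in> cohen_prod \<aa> \<and>
     (\<exists>\<alpha><\<Lambda>. decides q \<alpha> \<and> s \<subseteq>\<^sub>m follow (requests q) \<alpha>)}"

lemma name_stronger:
  assumes "(s, q) \<in> name" "cohen_prod_le \<aa> q r" "r \<in> cohen_prod \<aa>"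
  shows "(s, r) \<in> name"
proof -
  obtain \<alpha> where \<alpha>: "\<alpha> < \<Lambda>" "decides q \<alpha>" "s \<subseteq>\<^sub>m follow (requests q) \<alpha>"
    using assms(1) by (auto simp: name_def)
  have "follow (requests q) \<alpha> = follow (requests r) \<alpha>"
    using requests_stronger[OF \<alpha>(2) assms(2)] by (rule follow_cong)
  then show ?thesis
    using \<alpha> assms decides_stronger[OF \<alpha>(2) assms(2)] by (auto simp: name_def)
qed

text \<open>The stages increase, so the one at the larger index extends both conditions.\<close>

lemma name_directed:
  assumes "(s, q) \<in> name" "(s', q) \<in> name"
  shows "\<exists>u. (u, q) \<in> name \<and> s \<subseteq>\<^sub>m u \<and> s' \<subseteq>\<^sub>m u"
proof -
  obtain \<alpha> \<alpha>' where \<alpha>: "\<alpha> < \<Lambda>" "decides q \<alpha>" "s \<subseteq>\<^sub>m follow (requests q) \<alpha>"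
    "\<alpha>' < \<Lambda>" "decides q \<alpha>'" "s' \<subseteq>\<^sub>m follow (requests q) \<alpha>'"
    using assms by (auto simp: name_def)
  let ?\<gamma> = "max \<alpha> \<alpha>'" let ?u = "follow (requests q) ?\<gamma>"
  have \<gamma>: "?\<gamma> < \<Lambda>" "decides q ?\<gamma>" using \<alpha> by (auto simp: max_def)
  have "(?u, q) \<in> name"
    using \<gamma> assms(1) follow_cohen[OF regular_\<Lambda> requests_cohen[of q] \<gamma>(1)]
    unfolding name_def by (auto intro!: exI[of _ ?\<gamma>])
  moreover have "s \<subseteq>\<^sub>m ?u" "s' \<subseteq>\<^sub>m ?u"
    using \<alpha>(3,6) follow_mono[of \<alpha> ?\<gamma> "requests q"] follow_mono[of \<alpha>' ?\<gamma> "requests q"]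
    by (auto intro: map_le_trans)
  ultimately show ?thesis by blast
qed

section \<open>Density\<close>

text \<open>By injectivity fewer than \<open>\<kappa>\<close> pairs are coded below
  \<open>\<beta>\<close>, and regularity bounds their rows. Hence a condition of length
  \<open>\<beta>\<close> leaves all rows beyond \<open>g\<close> untouched.\<close>

lemma used_rows_bounded:
  assumes "\<kappa> \<in> \<aa>" "\<beta> < \<kappa>"
  shows "\<exists>g<\<kappa>. \<forall>\<gamma><\<kappa>. \<forall>\<theta><\<kappa>. \<pi> \<kappa> (\<gamma>, \<theta>) < \<beta> \<longrightarrow> \<gamma> \<le> g"
proof -
  let ?K = "{x \<in> {..<\<kappa>} \<times> {..<\<kappa>}. \<pi> \<kappa> x < \<beta>}"
  have "inj_on (\<pi> \<kappa>) ?K" using inj_\<pi>[OF assms(1)] by (rule inj_on_subset) auto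
  then have "|?K| \<le>o |{..<\<beta>}|" using card_of_ordLeq[of ?K "{..<\<beta>}"] by auto
  then have "|?K| <o |{..<\<kappa>}|"
    using card_of_lessThan_less assms regular is_regular_imp_is_cardinal ordLeq_ordLess_trans by blast
  then have "\<exists>g<\<kappa>. \<forall>x\<in>?K. fst x \<le> g"
    using regular[OF assms(1)] by (intro is_regular_image_bounded) auto
  then show ?thesis by fastforce
qed

text \<open>Regularity is used twice, within each row and then for the bounds of the rows. This lets
  one condition fill the whole rectangle.\<close>

lemma rectangle_bounded:
  assumes "\<kappa> \<in> \<aa>" "\<beta> < \<kappa>" "\<gamma>0 < \<kappa>" "\<theta>0 < \<kappa>"
  shows "\<exists>\<delta><\<kappa>. \<beta> \<le> \<delta> \<and> (\<forall>\<gamma>\<le>\<gamma>0. \<forall>\<theta><\<theta>0. \<pi> \<kappa> (\<gamma>, \<theta>) < \<delta>)"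
proof -
  have reg: "is_regular \<kappa>" using assms regular by simp
  \<comment> \<open>The rows up to and including \<open>\<gamma>0\<close> lie in the open segment
    below \<open>\<gamma>1\<close>, whose size is less than \<open>\<kappa>\<close>.\<close>
  obtain \<gamma>1 where \<gamma>1: "\<gamma>1 < \<kappa>" "\<gamma>0 < \<gamma>1" using is_regular_greater[OF reg assms(3)] by blast
  have less: "|{..<x}| <o |{..<\<kappa>}|" if "x < \<kappa>" for x
    using card_of_lessThan_less[OF is_regular_imp_is_cardinal[OF reg] that] .
  have "\<exists>b<\<kappa>. \<forall>\<theta>\<in>{..<\<theta>0}. \<pi> \<kappa> (\<gamma>, \<theta>) \<le> b" if "\<gamma> < \<gamma>1" for \<gamma>
    using that \<gamma>1(1) assms(1,4) less[OF assms(4)] \<pi>_less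
    by (intro is_regular_image_bounded[OF reg]) auto
  then obtain b where b: "\<And>\<gamma>. \<gamma> < \<gamma>1 \<Longrightarrow> b \<gamma> < \<kappa>"
    "\<And>\<gamma> \<theta>. \<gamma> < \<gamma>1 \<Longrightarrow> \<theta> < \<theta>0 \<Longrightarrow> \<pi> \<kappa> (\<gamma>, \<theta>) \<le> b \<gamma>" by (metis lessThan_iff)
  have "\<exists>x<\<kappa>. \<forall>\<gamma>\<in>{..<\<gamma>1}. b \<gamma> \<le> x"
    using b(1) less[OF \<gamma>1(1)] by (intro is_regular_image_bounded[OF reg]) auto
  then obtain x where x: "x < \<kappa>" "\<And>\<gamma>. \<gamma> < \<gamma>1 \<Longrightarrow> b \<gamma> \<le> x" by auto
  obtain \<delta> where \<delta>: "\<delta> < \<kappa>" "max x \<beta> < \<delta>"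
    using is_regular_greater[OF reg, of "max x \<beta>"] x(1) assms(2) by auto
  then have "\<pi> \<kappa> (\<gamma>, \<theta>) < \<delta>" if "\<gamma> \<le> \<gamma>0" "\<theta> < \<theta>0" for \<gamma> \<theta>
    using x(2)[of \<gamma>] b(2)[of \<gamma> \<theta>] that \<gamma>1(2) by (simp add: order_le_less_trans)
  then show ?thesis using \<delta> by (intro exI[of _ \<delta>]) auto
qed

text \<open>
  Choose a row \<open>\<alpha>\<close> of the scale that \<open>p\<close> leaves untouched modulo \<open>J\<close>, fill all other free
  positions with zeros, and write into row \<open>\<alpha>\<close> a code for an element of \<open>D\<close> above what
  the rows before \<open>\<alpha>\<close> have produced. Rows before \<open>\<alpha>\<close> differ from row \<open>\<alpha>\<close> modulo \<open>J\<close>, so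
  they do not notice the last step.
\<close>

lemma name_dense:
  assumes p: "p \<in> cohen_prod \<aa>" and D: "dense_in (cohen \<Lambda>) (\<subseteq>\<^sub>m) D"
  shows "\<exists>q\<in>cohen_prod \<aa>. cohen_prod_le \<aa> p q \<and> (\<exists>d\<in>D. (d, q) \<in> name)"
proof -
  have "\<forall>\<kappa>\<in>\<aa>. \<exists>\<beta><\<kappa>. dom (p \<kappa>) = {..<\<beta>}"
    using p by (auto simp: cohen_prod_def PiE_iff cohen_def)
  then obtain \<beta> where \<beta>: "\<And>\<kappa>. \<kappa> \<in> \<aa> \<Longrightarrow> \<beta> \<kappa> < \<kappa> \<and> dom (p \<kappa>) = {..<\<beta> \<kappa>}" by metis
  have "\<forall>\<kappa>\<in>\<aa>. \<exists>g<\<kappa>. \<forall>\<gamma><\<kappa>. \<forall>\<theta><\<kappa>. \<pi> \<kappa> (\<gamma>, \<theta>) < \<beta> \<kappa> \<longrightarrow> \<gamma> \<le> g"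
    using used_rows_bounded \<beta> by blast
  then obtain g where g: "\<And>\<kappa>. \<kappa> \<in> \<aa> \<Longrightarrow> g \<kappa> < \<kappa>"
    "\<And>\<kappa> \<gamma> \<theta>. \<kappa> \<in> \<aa> \<Longrightarrow> \<gamma> < \<kappa> \<Longrightarrow> \<theta> < \<kappa> \<Longrightarrow> \<pi> \<kappa> (\<gamma>, \<theta>) < \<beta> \<kappa> \<Longrightarrow> \<gamma> \<le> g \<kappa>"
    by metis
  \<comment> \<open>Modulo \<open>J\<close>, row \<open>\<alpha>\<close> lies beyond every row that
    \<open>p\<close> touches. Members of \<open>prod_card\<close> are extensional, hence the
    restriction of \<open>g\<close>.\<close>
  obtain \<alpha> where \<alpha>: "\<alpha> < \<Lambda>" "less_mod \<aa> J (restrict g \<aa>) (F \<alpha>)"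
    using F_cofinal[of "restrict g \<aa>"] g(1) by (auto simp: prod_card_def)
  have g_small: "{\<kappa>\<in>\<aa>. \<not> g \<kappa> < F \<alpha> \<kappa>} \<in> J"
    using \<alpha>(2) unfolding less_mod_def by (rule ideal_mono) auto
  \<comment> \<open>The length \<open>\<delta> \<kappa>\<close> of the new condition covers both
    \<open>p \<kappa>\<close> and all rows up to \<open>F \<alpha> \<kappa>\<close>, cut at
    \<open>h \<kappa>\<close>.\<close>
  have "\<forall>\<kappa>\<in>\<aa>. \<exists>\<delta><\<kappa>. \<beta> \<kappa> \<le> \<delta> \<and> (\<forall>\<gamma>\<le>F \<alpha> \<kappa>. \<forall>\<theta><h \<kappa>. \<pi> \<kappa> (\<gamma>, \<theta>) < \<delta>)"
    using rectangle_bounded \<beta> F_bound[OF \<alpha>(1)] h_less by blast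
  then obtain \<delta> where \<delta>: "\<And>\<kappa>. \<kappa> \<in> \<aa> \<Longrightarrow> \<delta> \<kappa> < \<kappa>" "\<And>\<kappa>. \<kappa> \<in> \<aa> \<Longrightarrow> \<beta> \<kappa> \<le> \<delta> \<kappa>"
    "\<And>\<kappa> \<gamma> \<theta>. \<kappa> \<in> \<aa> \<Longrightarrow> \<gamma> \<le> F \<alpha> \<kappa> \<Longrightarrow> \<theta> < h \<kappa> \<Longrightarrow> \<pi> \<kappa> (\<gamma>, \<theta>) < \<delta> \<kappa>"
    by metis
  \<comment> \<open>The final \<open>q\<close> depends on \<open>d\<close>, and \<open>d\<close> on
    the rows before \<open>\<alpha>\<close>. Filling with zeros first breaks the circle:
    \<open>p'\<close> has the same earlier rows as \<open>q\<close> modulo \<open>J\<close>,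
    although its sequences are total and no longer Cohen conditions.\<close>
  define p' where "p' \<kappa> x = (if x < \<beta> \<kappa> then p \<kappa> x else Some False)" for \<kappa> x
  have "follow_below (requests p') \<alpha> \<in> cohen \<Lambda>"
    using follow_cohen[OF regular_\<Lambda> requests_cohen] \<alpha>(1)
    by (intro map_Union_cohen[OF regular_\<Lambda> \<alpha>(1)]) auto
  then obtain d where d: "d \<in> D" "follow_below (requests p') \<alpha> \<subseteq>\<^sub>m d" "d \<in> cohen \<Lambda>"
    using D unfolding dense_in_def by blast
  obtain X where X: "X \<subseteq> {..<\<mu>}" "decode X = d" using d(3) decode_onto by (metis PowD imageE)
  \<comment> \<open>Row \<open>\<alpha>\<close> carries the code \<open>X\<close> of
    \<open>d\<close>. The guard \<open>\<theta> < \<kappa>\<close> reflects that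
    \<open>\<pi> \<kappa>\<close> is known to be injective only on pairs below
    \<open>\<kappa>\<close>.\<close>
  define q where "q = (\<lambda>\<kappa>\<in>\<aa>. \<lambda>x. if x < \<beta> \<kappa> then p \<kappa> x else if x < \<delta> \<kappa>
    then Some (\<exists>\<theta>\<in>X. \<theta> < \<kappa> \<and> x = \<pi> \<kappa> (F \<alpha> \<kappa>, \<theta>)) else None)"
  have dom_q: "dom (q \<kappa>) = {..<\<delta> \<kappa>}" if "\<kappa> \<in> \<aa>" for \<kappa>
  proof (rule set_eqI)
    fix x
    have "p \<kappa> x \<noteq> None \<longleftrightarrow> x < \<beta> \<kappa>" using \<beta>[OF that] by (metis domIff lessThan_iff)
    then show "x \<in> dom (q \<kappa>) \<longleftrightarrow> x \<in> {..<\<delta> \<kappa>}"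
      using \<delta>(2)[OF that] that by (auto simp: q_def domIff)
  qed
  have q: "q \<in> cohen_prod \<aa>"
    unfolding cohen_prod_def
  proof (rule PiE_I)
    show "q \<kappa> \<in> cohen \<kappa>" if "\<kappa> \<in> \<aa>" for \<kappa> using dom_q \<delta>(1) that by (auto simp: cohen_def)
  qed (simp add: q_def)
  have pq: "cohen_prod_le \<aa> p q" using \<beta> by (auto simp: cohen_prod_le_def map_le_def q_def)
  have F_le: "{\<kappa>\<in>\<aa>. \<not> F \<gamma> \<kappa> \<le> F \<alpha> \<kappa>} \<in> J" if "\<gamma> \<le> \<alpha>" for \<gamma>
  proof (cases "\<gamma> = \<alpha>")
    case True
    then show ?thesis using ideal by (simp add: ideal_on_def)
  next
    case False
    then have "less_mod \<aa> J (F \<gamma>) (F \<alpha>)" using F_less \<alpha>(1) that by simp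
    then show ?thesis unfolding less_mod_def by (rule ideal_mono) auto
  qed
  have dec: "decides q \<alpha>"
    unfolding decides_def
  proof (intro allI impI)
    fix \<gamma> \<theta> assume \<gamma>: "\<gamma> \<le> \<alpha>" and \<theta>: "\<theta> < \<mu>"
    show "{\<kappa>\<in>\<aa>. \<pi> \<kappa> (F \<gamma> \<kappa>, \<theta>) \<notin> dom (q \<kappa>)} \<in> J"
    proof (rule ideal_mono[OF ideal_Un[OF F_le[OF \<gamma>] h_large[OF \<theta>]]], rule subsetI, rule ccontr)
      fix \<kappa>
      assume "\<kappa> \<in> {\<kappa>\<in>\<aa>. \<pi> \<kappa> (F \<gamma> \<kappa>, \<theta>) \<notin> dom (q \<kappa>)}"
        "\<kappa> \<notin> {\<kappa>\<in>\<aa>. \<not> F \<gamma> \<kappa> \<le> F \<alpha> \<kappa>} \<union> {\<kappa>\<in>\<aa>. \<not> \<theta> < h \<kappa>}"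
      then have "\<kappa> \<in> \<aa>" "\<pi> \<kappa> (F \<gamma> \<kappa>, \<theta>) \<notin> dom (q \<kappa>)" "F \<gamma> \<kappa> \<le> F \<alpha> \<kappa>" "\<theta> < h \<kappa>"
        by blast+
      then show False using \<delta>(3) dom_q by simp
    qed
  qed
  \<comment> \<open>For almost all \<open>\<kappa>\<close> the two row indices differ, so by
    injectivity no position of row \<open>\<gamma>\<close> inside the cut is one where
    \<open>X\<close> is written.\<close>
  have "read p' \<gamma> = read q \<gamma>" if "\<gamma> < \<alpha>" for \<gamma>
  proof (rule read_cong)
    fix \<theta> assume \<theta>: "\<theta> < \<mu>"
    have "{\<kappa>\<in>\<aa>. \<not> F \<gamma> \<kappa> < F \<alpha> \<kappa>} \<in> J" using F_less[OF that \<alpha>(1)] by (simp add: less_mod_def)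
    note small = ideal_Un[OF this h_large[OF \<theta>]]
    have "p' \<kappa> (\<pi> \<kappa> (F \<gamma> \<kappa>, \<theta>)) = q \<kappa> (\<pi> \<kappa> (F \<gamma> \<kappa>, \<theta>))"
      if \<kappa>: "\<kappa> \<in> \<aa>" "F \<gamma> \<kappa> < F \<alpha> \<kappa>" "\<theta> < h \<kappa>" for \<kappa>
    proof -
      have "\<pi> \<kappa> (F \<gamma> \<kappa>, \<theta>) \<noteq> \<pi> \<kappa> (F \<alpha> \<kappa>, \<theta>')" if "\<theta>' < \<kappa>" for \<theta>'
      proof
        assume "\<pi> \<kappa> (F \<gamma> \<kappa>, \<theta>) = \<pi> \<kappa> (F \<alpha> \<kappa>, \<theta>')"
        moreover have "F \<gamma> \<kappa> < \<kappa>" "\<theta> < \<kappa>"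
          using \<kappa>(2,3) F_bound[OF \<alpha>(1) \<kappa>(1)] h_less[OF \<kappa>(1)] by simp_all
        ultimately have "F \<gamma> \<kappa> = F \<alpha> \<kappa>"
          using \<pi>_eqD(1) \<kappa>(1) that F_bound[OF \<alpha>(1) \<kappa>(1)] by blast
        then show False using \<kappa>(2) by simp
      qed
      then show ?thesis using \<delta>(3)[OF \<kappa>(1) less_imp_le[OF \<kappa>(2)] \<kappa>(3)] \<kappa>(1) by (auto simp: p'_def q_def)
    qed
    then show "{\<kappa>\<in>\<aa>. p' \<kappa> (\<pi> \<kappa> (F \<gamma> \<kappa>, \<theta>)) \<noteq> q \<kappa> (\<pi> \<kappa> (F \<gamma> \<kappa>, \<theta>))} \<in> J"
      by (intro ideal_mono[OF small]) auto
  qed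
  then have "follow (requests p') \<gamma> = follow (requests q) \<gamma>" if "\<gamma> < \<alpha>" for \<gamma>
    using that by (intro follow_cong) auto
  then have below: "follow_below (requests p') \<alpha> = follow_below (requests q) \<alpha>"
    by (intro arg_cong[of _ _ map_Union] image_cong) auto
  have "read q \<alpha> = X"
  proof -
    \<comment> \<open>Where \<open>g \<kappa> < F \<alpha> \<kappa>\<close>, the condition
      \<open>p\<close> says nothing about row \<open>\<alpha>\<close>, and
      \<open>\<theta> < h \<kappa>\<close> puts the position below \<open>\<delta> \<kappa>\<close>;
      so the bit is the one written for \<open>X\<close>.\<close>
    have "{\<kappa>\<in>\<aa>. q \<kappa> (\<pi> \<kappa> (F \<alpha> \<kappa>, \<theta>)) \<noteq> Some (\<theta> \<in> X)} \<in> J" if \<theta>: "\<theta> < \<mu>" for \<theta>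
    proof -
      have "q \<kappa> (\<pi> \<kappa> (F \<alpha> \<kappa>, \<theta>)) = Some (\<theta> \<in> X)"
        if \<kappa>: "\<kappa> \<in> \<aa>" "g \<kappa> < F \<alpha> \<kappa>" "\<theta> < h \<kappa>" for \<kappa>
      proof -
        have \<theta>\<kappa>: "\<theta> < \<kappa>" using \<kappa>(3) h_less[OF \<kappa>(1)] by simp
        have "\<not> \<pi> \<kappa> (F \<alpha> \<kappa>, \<theta>) < \<beta> \<kappa>"
          using g(2)[OF \<kappa>(1) F_bound[OF \<alpha>(1) \<kappa>(1)] \<theta>\<kappa>] \<kappa>(2) by auto
        moreover have "\<theta>' = \<theta>" if "\<theta>' < \<kappa>" "\<pi> \<kappa> (F \<alpha> \<kappa>, \<theta>) = \<pi> \<kappa> (F \<alpha> \<kappa>, \<theta>')" for \<theta>'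
          using \<pi>_eqD(2)[OF that(2) \<kappa>(1)] that(1) \<theta>\<kappa> F_bound[OF \<alpha>(1) \<kappa>(1)] by simp
        ultimately show ?thesis
          using \<delta>(3)[OF \<kappa>(1) order_refl \<kappa>(3)] \<kappa>(1) \<theta>\<kappa> by (auto simp: q_def)
      qed
      then show ?thesis by (intro ideal_mono[OF ideal_Un[OF g_small h_large[OF \<theta>]]]) auto
    qed
    note small = this
    have "{\<kappa>\<in>\<aa>. q \<kappa> (\<pi> \<kappa> (F \<alpha> \<kappa>, \<theta>)) \<noteq> Some True} \<in> J \<longleftrightarrow> \<theta> \<in> X" if \<theta>: "\<theta> < \<mu>" for \<theta>
    proof
      assume "{\<kappa>\<in>\<aa>. q \<kappa> (\<pi> \<kappa> (F \<alpha> \<kappa>, \<theta>)) \<noteq> Some True} \<in> J"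
      \<comment> \<open>As \<open>J\<close> is proper, the two small sets leave out some
        \<open>\<kappa>\<close>, and there the bit is both \<open>True\<close> and the truth value
        of \<open>\<theta> \<in> X\<close>.\<close>
      from ideal_mono[OF ideal_Un[OF this small[OF \<theta>]], of \<aa>] ideal_proper
      have "\<not> \<aa> \<subseteq> {\<kappa>\<in>\<aa>. q \<kappa> (\<pi> \<kappa> (F \<alpha> \<kappa>, \<theta>)) \<noteq> Some True} \<union>
          {\<kappa>\<in>\<aa>. q \<kappa> (\<pi> \<kappa> (F \<alpha> \<kappa>, \<theta>)) \<noteq> Some (\<theta> \<in> X)}" by blast
      then show "\<theta> \<in> X" by auto
    next
      assume "\<theta> \<in> X"
      then show "{\<kappa>\<in>\<aa>. q \<kappa> (\<pi> \<kappa> (F \<alpha> \<kappa>, \<theta>)) \<noteq> Some True} \<in> J" using small[OF \<theta>] by simp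
    qed
    then show ?thesis using X(1) by (auto simp: read_def)
  qed
  \<comment> \<open>The request \<open>d\<close> extends all earlier stages, so
    \<open>follow\<close> accepts it.\<close>
  then have "follow (requests q) \<alpha> = d"
    using follow_eq[of "requests q" \<alpha>] d(2) X(2) below by simp
  then have "(d, q) \<in> name" using q dec d(3) \<alpha>(1) by (auto simp: name_def)
  then show ?thesis using q pq d(1) by blast
qed

section \<open>Forcing statements about the name\<close>

lemma cohen_prod_le_refl: "cohen_prod_le \<aa> p p"
  by (simp add: cohen_prod_le_def)

lemma cohen_prod_le_trans: "cohen_prod_le \<aa> p q \<Longrightarrow> cohen_prod_le \<aa> q r \<Longrightarrow> cohen_prod_le \<aa> p r"
  unfolding cohen_prod_le_def using map_le_trans by blast

text \<open>By \<open>name_stronger\<close> the weaker witness in \<open>forces_mem\<close> can be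
  replaced by the stronger condition itself, so forcing membership becomes plain density.\<close>

lemma forces_mem_name_iff:
  assumes "p \<in> cohen_prod \<aa>"
  shows "forces_mem (cohen_prod \<aa>) (cohen_prod_le \<aa>) s name p \<longleftrightarrow>
    (\<forall>q\<in>cohen_prod \<aa>. cohen_prod_le \<aa> p q \<longrightarrow>
      (\<exists>r\<in>cohen_prod \<aa>. cohen_prod_le \<aa> q r \<and> (s, r) \<in> name))"
proof -
  have "(\<exists>t. (s, t) \<in> name \<and> cohen_prod_le \<aa> t r) \<longleftrightarrow> (s, r) \<in> name"
    if "r \<in> cohen_prod \<aa>" for r
    using name_stronger[OF _ _ that] cohen_prod_le_refl by blast
  then show ?thesis unfolding forces_mem_def dense_below_def by simp
qed

lemma name_forces_mem:
  assumes "(s, q) \<in> name"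
  shows "forces_mem (cohen_prod \<aa>) (cohen_prod_le \<aa>) s name q"
proof -
  have "q \<in> cohen_prod \<aa>" using assms by (simp add: name_def)
  then show ?thesis
    using forces_mem_name_iff name_stronger[OF assms] cohen_prod_le_refl by blast
qed

lemma forces_ex_dense:
  assumes "p \<in> cohen_prod \<aa>" "dense_in (cohen \<Lambda>) (\<subseteq>\<^sub>m) D"
  shows "forces_ex (cohen_prod \<aa>) (cohen_prod_le \<aa>) D
    (\<lambda>d. forces_mem (cohen_prod \<aa>) (cohen_prod_le \<aa>) d name) p"
  unfolding forces_ex_def dense_below_def
proof (intro ballI impI)
  fix q assume "q \<in> cohen_prod \<aa>"
  from name_dense[OF this assms(2)] obtain r d
    where "r \<in> cohen_prod \<aa>" "cohen_prod_le \<aa> q r" "d \<in> D" "(d, r) \<in> name" by blast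
  then show "\<exists>r\<in>cohen_prod \<aa>. cohen_prod_le \<aa> q r \<and>
      r \<in> {r. \<exists>d\<in>D. forces_mem (cohen_prod \<aa>) (cohen_prod_le \<aa>) d name r}"
    using name_forces_mem by (intro bexI[of _ r]) auto
qed

lemma forces_generic_filter_name:
  assumes p: "p \<in> cohen_prod \<aa>"
  shows "forces_generic_filter (cohen_prod \<aa>) (cohen_prod_le \<aa>) (cohen \<Lambda>) (\<subseteq>\<^sub>m) name p"
  unfolding forces_generic_filter_def
proof (intro conjI allI ballI impI)
  \<comment> \<open>Nonemptiness is the case of genericity in which the dense set is the whole
    forcing.\<close>
  have "dense_in (cohen \<Lambda>) (\<subseteq>\<^sub>m) (cohen \<Lambda>)"
    unfolding dense_in_def using map_le_refl by blast
  then show "forces_ex (cohen_prod \<aa>) (cohen_prod_le \<aa>) (cohen \<Lambda>)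
      (\<lambda>q. forces_mem (cohen_prod \<aa>) (cohen_prod_le \<aa>) q name) p"
    using p by (rule forces_ex_dense[rotated])
next
  fix s s' :: "'o \<rightharpoonup> bool" assume s: "s \<in> cohen \<Lambda>" "s' \<in> cohen \<Lambda>" "s' \<subseteq>\<^sub>m s"
  have "(s', q) \<in> name" if "(s, q) \<in> name" for q
    using that s map_le_trans[OF s(3)] by (auto simp: name_def)
  then show "forces_imp (cohen_prod \<aa>) (cohen_prod_le \<aa>)
      (forces_mem (cohen_prod \<aa>) (cohen_prod_le \<aa>) s name)
      (forces_mem (cohen_prod \<aa>) (cohen_prod_le \<aa>) s' name) p"
    unfolding forces_imp_def by (simp add: forces_mem_name_iff) blast
next
  fix s s' :: "'o \<rightharpoonup> bool"
  let ?S = "{u \<in> cohen \<Lambda>. s \<subseteq>\<^sub>m u \<and> s' \<subseteq>\<^sub>m u}"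
  show "forces_imp (cohen_prod \<aa>) (cohen_prod_le \<aa>)
      (\<lambda>r. forces_mem (cohen_prod \<aa>) (cohen_prod_le \<aa>) s name r \<and>
        forces_mem (cohen_prod \<aa>) (cohen_prod_le \<aa>) s' name r)
      (forces_ex (cohen_prod \<aa>) (cohen_prod_le \<aa>) ?S
        (\<lambda>u. forces_mem (cohen_prod \<aa>) (cohen_prod_le \<aa>) u name)) p"
    unfolding forces_imp_def forces_ex_def dense_below_def
  proof (intro ballI impI)
    fix q r
    assume q: "q \<in> cohen_prod \<aa>" and r: "r \<in> cohen_prod \<aa>" "cohen_prod_le \<aa> q r"
      and "cohen_prod_le \<aa> p q \<and> forces_mem (cohen_prod \<aa>) (cohen_prod_le \<aa>) s name q \<and>
        forces_mem (cohen_prod \<aa>) (cohen_prod_le \<aa>) s' name q"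
    \<comment> \<open>Strengthen first to put \<open>s\<close> into the filter, then to put
      \<open>s'\<close> into it; the first membership persists.\<close>
    then obtain x where x: "x \<in> cohen_prod \<aa>" "cohen_prod_le \<aa> r x" "(s, x) \<in> name"
      and "\<forall>r\<in>cohen_prod \<aa>. cohen_prod_le \<aa> q r \<longrightarrow>
        (\<exists>y\<in>cohen_prod \<aa>. cohen_prod_le \<aa> r y \<and> (s', y) \<in> name)"
      by (auto simp: forces_mem_name_iff[OF q])
    then obtain y where y: "y \<in> cohen_prod \<aa>" "cohen_prod_le \<aa> x y" "(s', y) \<in> name"
      using r cohen_prod_le_trans by blast
    obtain u where u: "(u, y) \<in> name" "s \<subseteq>\<^sub>m u" "s' \<subseteq>\<^sub>m u"
      using name_directed name_stronger[OF x(3) y(2,1)] y(3) by blast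
    have "u \<in> ?S" using u by (auto simp: name_def)
    then show "\<exists>r'\<in>cohen_prod \<aa>. cohen_prod_le \<aa> r r' \<and> r' \<in> {r. \<exists>u\<in>?S.
        forces_mem (cohen_prod \<aa>) (cohen_prod_le \<aa>) u name r}"
      using y(1) cohen_prod_le_trans[OF x(2) y(2)] name_forces_mem[OF u(1)] by blast
  qed
next
  fix D :: "('o \<rightharpoonup> bool) set" assume "dense_in (cohen \<Lambda>) (\<subseteq>\<^sub>m) D"
  then show "forces_ex (cohen_prod \<aa>) (cohen_prod_le \<aa>) D
      (\<lambda>d. forces_mem (cohen_prod \<aa>) (cohen_prod_le \<aa>) d name) p"
    using p by (rule forces_ex_dense[rotated])
qed

lemma adds_generic_cohen: "adds_generic (cohen_prod \<aa>) (cohen_prod_le \<aa>) (cohen \<Lambda>) (\<subseteq>\<^sub>m)"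
proof -
  have "name \<in> Pow (cohen \<Lambda> \<times> cohen_prod \<aa>)" by (auto simp: name_def)
  then show ?thesis
    unfolding adds_generic_def forces_ex_def dense_below_def
    using forces_generic_filter_name cohen_prod_le_refl
    by (metis (mono_tags, lifting) mem_Collect_eq)
qed

end

section \<open>From a scale to the coding\<close>

text \<open>Each constant \<open>\<theta> < \<mu>\<close> is dominated modulo \<open>J\<close> by a
  member of the scale. These are only \<open>\<mu>\<close> many indices, so regularity of
  \<open>\<Lambda>\<close> gives one member that works for all \<open>\<theta>\<close>.\<close>

lemma ex_diverging_mod_ideal:
  assumes reg: "\<forall>\<kappa>\<in>\<aa>. is_regular \<kappa>" and sup: "is_sup \<aa> \<mu>"
    and "\<mu> < \<Lambda>" and \<Lambda>: "is_regular \<Lambda>" and J: "ideal_on \<aa> J"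
    and bounded: "\<And>\<bb>. bounded_subset \<aa> \<bb> \<Longrightarrow> \<bb> \<in> J"
    and F_prod: "\<And>\<alpha>. \<alpha> < \<Lambda> \<Longrightarrow> F \<alpha> \<in> prod_card \<aa>"
    and F_less: "\<And>\<alpha> \<beta>. \<alpha> < \<beta> \<Longrightarrow> \<beta> < \<Lambda> \<Longrightarrow> less_mod \<aa> J (F \<alpha>) (F \<beta>)"
    and F_cofinal: "\<And>g. g \<in> prod_card \<aa> \<Longrightarrow> \<exists>\<alpha><\<Lambda>. less_mod \<aa> J g (F \<alpha>)"
  obtains h where "h \<in> prod_card \<aa>" "\<And>\<theta>. \<theta> < \<mu> \<Longrightarrow> {\<kappa>\<in>\<aa>. \<not> \<theta> < h \<kappa>} \<in> J"
proof -
  have mono: "Y \<in> J" if "X \<in> J" "Y \<subseteq> X" for X Y using J that by (auto simp: ideal_on_def)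
  have Un: "X \<union> Y \<in> J" if "X \<in> J" "Y \<in> J" for X Y using J that by (auto simp: ideal_on_def)
  have "\<exists>\<alpha><\<Lambda>. {\<kappa>\<in>\<aa>. \<not> \<theta> < F \<alpha> \<kappa>} \<in> J" if \<theta>: "\<theta> < \<mu>" for \<theta>
  proof -
    \<comment> \<open>At \<open>\<kappa> \<le> \<theta>\<close> the constant is not an admissible
      value, so an arbitrary one is taken; such \<open>\<kappa>\<close> form the bounded set
      \<open>?b\<close>.\<close>
    let ?c = "\<lambda>\<kappa>\<in>\<aa>. if \<theta> < \<kappa> then \<theta> else (SOME x. x < \<kappa>)"
    have "(SOME x. x < \<kappa>) < \<kappa>" if "\<kappa> \<in> \<aa>" for \<kappa>
    proof (rule someI_ex)
      have "{..<\<kappa>} \<noteq> {}" using is_regular_infinite[of \<kappa>] reg that by auto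
      then show "\<exists>x. x < \<kappa>" by auto
    qed
    then have "?c \<in> prod_card \<aa>" by (auto simp: prod_card_def)
    then obtain \<alpha> where \<alpha>: "\<alpha> < \<Lambda>" "{\<kappa>\<in>\<aa>. \<not> ?c \<kappa> < F \<alpha> \<kappa>} \<in> J"
      using F_cofinal unfolding less_mod_def by blast
    let ?b = "{\<kappa>\<in>\<aa>. \<kappa> \<le> \<theta>}"
    \<comment> \<open>\<open>bounded_subset\<close> asks for an actual supremum; the well-order
      supplies a least upper bound, which is at most \<open>\<theta>\<close> and so below
      \<open>\<mu>\<close>.\<close>
    let ?s = "LEAST u. \<forall>x\<in>?b. x \<le> u"
    have ub: "\<forall>x\<in>?b. x \<le> \<theta>" by simp
    have "\<forall>x\<in>?b. x \<le> ?s" using ub by (rule LeastI)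
    then have "is_sup ?b ?s" unfolding is_sup_def using Least_le[of "\<lambda>u. \<forall>x\<in>?b. x \<le> u"] by blast
    moreover have "?s < \<mu>" using Least_le[of "\<lambda>u. \<forall>x\<in>?b. x \<le> u", OF ub] \<theta> by simp
    ultimately have "?b \<in> J" using sup by (intro bounded) (auto simp: bounded_subset_def)
    from Un[OF \<alpha>(2) this] have "{\<kappa>\<in>\<aa>. \<not> \<theta> < F \<alpha> \<kappa>} \<in> J"
      by (rule mono) auto
    then show ?thesis using \<alpha>(1) by blast
  qed
  then obtain A where A: "\<And>\<theta>. \<theta> < \<mu> \<Longrightarrow> A \<theta> < \<Lambda> \<and> {\<kappa>\<in>\<aa>. \<not> \<theta> < F (A \<theta>) \<kappa>} \<in> J" by metis
  obtain \<alpha> where \<alpha>: "\<alpha> < \<Lambda>" "\<forall>\<theta>\<in>{..<\<mu>}. A \<theta> \<le> \<alpha>"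
    using is_regular_image_bounded[OF \<Lambda>, of A "{..<\<mu>}"] A
      card_of_lessThan_less[OF is_regular_imp_is_cardinal[OF \<Lambda>] assms(3)] by blast
  show ?thesis
  proof (rule that[OF F_prod[OF \<alpha>(1)]])
    fix \<theta> assume \<theta>: "\<theta> < \<mu>"
    show "{\<kappa>\<in>\<aa>. \<not> \<theta> < F \<alpha> \<kappa>} \<in> J"
    proof (cases "A \<theta> = \<alpha>")
      case True
      then show ?thesis using A[OF \<theta>] by simp
    next
      case False
      then have "{\<kappa>\<in>\<aa>. \<not> F (A \<theta>) \<kappa> < F \<alpha> \<kappa>} \<in> J"
        using F_less[of "A \<theta>" \<alpha>] \<alpha> \<theta> by (simp add: less_mod_def less_le)
      from Un[OF this conjunct2[OF A[OF \<theta>]]] show ?thesis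
      proof (rule mono)
        show "{\<kappa>\<in>\<aa>. \<not> \<theta> < F \<alpha> \<kappa>} \<subseteq>
            {\<kappa>\<in>\<aa>. \<not> F (A \<theta>) \<kappa> < F \<alpha> \<kappa>} \<union> {\<kappa>\<in>\<aa>. \<not> \<theta> < F (A \<theta>) \<kappa>}"
          using less_trans by blast
      qed
    qed
  qed
qed

theorem theorem3:
  fixes \<aa> :: "'o::wellorder set" and \<mu> \<Lambda> :: 'o
  assumes "\<forall>\<kappa>\<in>\<aa>. is_regular \<kappa>"
    and "is_sup \<aa> \<mu>" and "\<mu> \<notin> \<aa>"
    and "is_cardinal \<Lambda>" and "\<mu> < \<Lambda>"
    and "is_two_less_power \<Lambda> (ctwo ^c ord_rel \<mu>)"
    and "\<Lambda> \<in> pcf \<aa>"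
    and "\<exists>J. ideal_on \<aa> J \<and> (\<forall>\<bb>. bounded_subset \<aa> \<bb> \<longrightarrow> \<bb> \<in> J) \<and> is_tcf \<aa> J \<Lambda>"
  shows "adds_generic (cohen_prod \<aa>) (cohen_prod_le \<aa>) (cohen \<Lambda>) (\<subseteq>\<^sub>m)"
proof -
  obtain J F where J: "ideal_on \<aa> J" "\<And>\<bb>. bounded_subset \<aa> \<bb> \<Longrightarrow> \<bb> \<in> J"
    and \<Lambda>: "is_regular \<Lambda>"
    and F: "\<And>\<alpha>. \<alpha> < \<Lambda> \<Longrightarrow> F \<alpha> \<in> prod_card \<aa>"
      "\<And>\<alpha> \<beta>. \<alpha> < \<beta> \<Longrightarrow> \<beta> < \<Lambda> \<Longrightarrow> less_mod \<aa> J (F \<alpha>) (F \<beta>)"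
      "\<And>g. g \<in> prod_card \<aa> \<Longrightarrow> \<exists>\<alpha><\<Lambda>. less_mod \<aa> J g (F \<alpha>)"
    using assms(8) unfolding is_tcf_def by blast
  obtain h where h: "h \<in> prod_card \<aa>" "\<And>\<theta>. \<theta> < \<mu> \<Longrightarrow> {\<kappa>\<in>\<aa>. \<not> \<theta> < h \<kappa>} \<in> J"
    using ex_diverging_mod_ideal[OF assms(1,2,5) \<Lambda> J F] by blast
  have "\<forall>\<kappa>\<in>\<aa>. \<exists>f. inj_on f ({..<\<kappa>} \<times> {..<\<kappa>}) \<and> f ` ({..<\<kappa>} \<times> {..<\<kappa>}) \<subseteq> {..<\<kappa>}"
    using assms(1) is_regular_pairing by blast
  then obtain \<pi> where \<pi>: "\<And>\<kappa>. \<kappa> \<in> \<aa> \<Longrightarrow> inj_on (\<pi> \<kappa>) ({..<\<kappa>} \<times> {..<\<kappa>})"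
    "\<And>\<kappa>. \<kappa> \<in> \<aa> \<Longrightarrow> \<pi> \<kappa> ` ({..<\<kappa>} \<times> {..<\<kappa>}) \<subseteq> {..<\<kappa>}" by metis
  \<comment> \<open>Properness of \<open>J\<close> excludes the empty set, so \<open>\<mu>\<close>
    lies above an infinite cardinal, as the counting of conditions requires.\<close>
  have "\<aa> \<noteq> {}" using J(1) by (auto simp: ideal_on_def)
  then obtain \<kappa> where "\<kappa> \<in> \<aa>" by blast
  then have "{..<\<kappa>} \<subseteq> {..<\<mu>}" "infinite {..<\<kappa>}"
    using assms(1,2) is_regular_infinite by (auto simp: is_sup_def)
  then have "infinite {..<\<mu>}" using infinite_super by blast
  from card_of_cohen[OF assms(4,5) this assms(6)]
  have le: "|cohen \<Lambda>| \<le>o |Pow {..<\<mu>}|" .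
  \<comment> \<open>The cardinal inequality yields a surjection from \<open>Pow {..<\<mu>}\<close>
    once the target is known to be nonempty.\<close>
  have ne: "cohen \<Lambda> \<noteq> {}"
  proof -
    have "(\<lambda>x. if x < \<mu> then Some True else None) \<in> cohen \<Lambda>"
      using assms(5) by (auto simp: cohen_def dom_def intro!: exI[of _ \<mu>])
    then show ?thesis by blast
  qed
  obtain decode where decode: "decode ` Pow {..<\<mu>} = cohen \<Lambda>"
    using iffD2[OF card_of_ordLeq2[OF ne] le] by (rule exE)
  interpret coding \<aa> J \<mu> \<Lambda> F h \<pi> decode
  proof
    show "is_regular \<kappa>" if "\<kappa> \<in> \<aa>" for \<kappa> using assms(1) that by blast
    show "h \<kappa> < \<kappa>" if "\<kappa> \<in> \<aa>" for \<kappa> using h(1) that by (auto simp: prod_card_def PiE_iff)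
    show "\<pi> \<kappa> (\<gamma>, \<theta>) < \<kappa>" if "\<kappa> \<in> \<aa>" "\<gamma> < \<kappa>" "\<theta> < \<kappa>" for \<kappa> \<gamma> \<theta>
      using \<pi>(2)[OF that(1)] that(2,3) by (auto simp: image_subset_iff)
  qed (fact \<Lambda> J(1) F h(2) \<pi>(1) decode)+
  show ?thesis by (rule adds_generic_cohen)
qed

end
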